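(* For every integer $k\geq 3$, $s(3,k)=2k-1$; moreover, $s(3,2)=4$.
   Context: A $d$-dimensional brick is a set $I_1\times\cdots\times I_d\subset\mathbb{R}^d$ where each $I_i=[a_i,b_i]$ is a closed bounded interval with $a_i<b_i$. A brick partition of a $d$-dimensional brick $B$ is a finite collection $\{B_1,\ldots,B_m\}$ of $d$-dimensional bricks whose union is $B$ and whose interiors are pairwise disjoint (the parts may share boundary points, but no interior points). Its size is the number $m$ of bricks. A plane is axis-parallel if each coordinate axis is either parallel or orthogonal to it; in $\mathbb{R}^3$ these are exactly the planes $\{x\in\mathbb{R}^3: x_i=c\}$ with $i\in\{1,2,3\}$ and $c\in\mathbb{R}$. A brick partition $\{B_1,\ldots,B_m\}$ of $B$ is $k$-slicing if every axis-parallel $2$-dimensional plane that meets $B$ (including planes containing a face of $B$) intersects at least $k$ distinct bricks $B_i$; here the bricks are closed sets, so touching a brick in boundary points counts as intersecting it. $s(d,k)$ denotes the minimum size of a $k$-slicing brick partition of a $d$-dimensional brick (by rescaling the coordinates and translating, this does not depend on the choice of the brick). *)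

theory Defs
  imports "HOL-Analysis.Analysis" "HOL-Library.Extended_Nat"
begin

definition brick :: "(real ^ 'n) set \<Rightarrow> bool" where
  "brick B \<longleftrightarrow> (\<exists>a b. (\<forall>i. a $ i < b $ i) \<and> B = cbox a b)"

definition brick_partition :: "(real ^ 'n) set \<Rightarrow> (real ^ 'n) set set \<Rightarrow> bool" where
  "brick_partition B P \<longleftrightarrow>
     finite P \<and> (\<forall>A\<in>P. brick A) \<and> \<Union>P = B \<and>
     pairwise (\<lambda>A C. interior A \<inter> interior C = {}) P"

text \<open>
  The two alternatives for the coordinate axis i: it is parallel to the plane
  (possibly contained in it), or orthogonal to it.
\<close>

definition axis_parallel_plane :: "(real ^ 'n) set \<Rightarrow> bool" where
  "axis_parallel_plane H \<longleftrightarrow>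
     affine H \<and> aff_dim H = 2 \<and>
     (\<forall>i. (\<forall>x\<in>H. \<forall>t. x + t *\<^sub>R axis i 1 \<in> H) \<or>
          (\<forall>x\<in>H. \<forall>y\<in>H. orthogonal (x - y) (axis i 1)))"

definition slicing :: "nat \<Rightarrow> (real ^ 'n) set \<Rightarrow> (real ^ 'n) set set \<Rightarrow> bool" where
  "slicing k B P \<longleftrightarrow>
     brick_partition B P \<and>
     (\<forall>H. axis_parallel_plane H \<and> H \<inter> B \<noteq> {} \<longrightarrow> k \<le> card {A \<in> P. A \<inter> H \<noteq> {}})"

text \<open>
  This is the number $s(d,k)$ computed for the given brick, with $d$ = CARD('n). The infimum is taken
  in the extended naturals, so that it is infinite if there is no $k$-slicing brick partition;
  if it is finite, it is attained and hence a minimum.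
\<close>

definition min_slicing_size :: "(real ^ 'n) set \<Rightarrow> nat \<Rightarrow> enat" where
  "min_slicing_size B k = Inf {enat (card P) | P. slicing k B P}"

lemma min_slicing_size_eq_enat_iff:
  "min_slicing_size B k = enat m \<longleftrightarrow>
     (\<exists>P. slicing k B P \<and> card P = m) \<and> (\<forall>P. slicing k B P \<longrightarrow> m \<le> card P)"
proof
  define S where "S = {enat (card P) | P. slicing k B P}"
  assume "min_slicing_size B k = enat m"
  then have *: "Inf S = enat m"
    by (simp add: min_slicing_size_def S_def)
  then have "S \<noteq> {}"
    by (auto simp: Inf_enat_def)
  then obtain s where "s \<in> S" by blast
  then have "Inf S \<in> S"
    unfolding Inf_enat_def by (auto intro: LeastI)
  then have "enat m \<in> S"
    by (simp add: *)
  moreover have "enat m \<le> x" if "x \<in> S" for x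
    using Inf_lower[OF that] * by simp
  ultimately show "(\<exists>P. slicing k B P \<and> card P = m) \<and> (\<forall>P. slicing k B P \<longrightarrow> m \<le> card P)"
    unfolding S_def by (force simp flip: enat_ord_simps(1))
next
  assume "(\<exists>P. slicing k B P \<and> card P = m) \<and> (\<forall>P. slicing k B P \<longrightarrow> m \<le> card P)"
  then show "min_slicing_size B k = enat m"
    unfolding min_slicing_size_def
    by (intro antisym Inf_lower Inf_greatest) auto
qed

lemma axis_parallel_plane_3:
  fixes H :: "(real ^ 3) set"
  shows "axis_parallel_plane H \<longleftrightarrow> (\<exists>i c. H = {x. x $ i = c})"
proof
  assume *: "axis_parallel_plane H"
  then have aff: "affine H" and dim: "aff_dim H = 2"
    by (auto simp: axis_parallel_plane_def)
  have ne: "H \<noteq> {}" using dim by auto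
  then obtain p where p: "p \<in> H" by auto
  have "\<exists>i. \<forall>x\<in>H. \<forall>y\<in>H. orthogonal (x - y) (axis i 1)"
  proof (rule ccontr)
    assume "\<not> ?thesis"
    then have par: "x + t *\<^sub>R axis i 1 \<in> H" if "x \<in> H" for x t i
      using * that unfolding axis_parallel_plane_def by blast
    have "y \<in> H" for y
    proof -
      have "p + (y $ 1 - p $ 1) *\<^sub>R axis 1 1 + (y $ 2 - p $ 2) *\<^sub>R axis 2 1
              + (y $ 3 - p $ 3) *\<^sub>R axis 3 1 \<in> H"
        using p by (intro par)
      also have "p + (y $ 1 - p $ 1) *\<^sub>R axis 1 1 + (y $ 2 - p $ 2) *\<^sub>R axis 2 1
              + (y $ 3 - p $ 3) *\<^sub>R axis 3 1 = y"
        by (simp add: vec_eq_iff forall_3 axis_def)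
      finally show ?thesis .
    qed
    then have "H = UNIV" by auto
    with dim show False by simp
  qed
  then obtain i where i: "\<forall>x\<in>H. \<forall>y\<in>H. orthogonal (x - y) (axis i 1)" by blast
  have plane: "{x. x $ j = c} = {x. axis j 1 \<bullet> x = c}" for j :: 3 and c :: real
    by (simp add: cart_eq_inner_axis inner_commute)
  have "x $ i = p $ i" if "x \<in> H" for x
  proof -
    have "(x - p) $ i = 0"
      using i p that unfolding orthogonal_def cart_eq_inner_axis by blast
    then show ?thesis by simp
  qed
  then have "H \<subseteq> {x. x $ i = p $ i}"
    by blast
  then have sub: "H \<subseteq> {x. axis i 1 \<bullet> x = p $ i}"
    by (simp only: plane)
  have "aff_dim {x. axis i (1::real) \<bullet> x = p $ i} = int (DIM(real ^ 3) - 1)"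
    by (rule aff_dim_hyperplane) simp
  then have "H = {x. axis i 1 \<bullet> x = p $ i}"
    using sub aff ne dim affine_hyperplane by (intro affine_dim_equal) simp_all
  then have "H = {x. x $ i = p $ i}"
    by (simp only: plane)
  then show "\<exists>i c. H = {x. x $ i = c}"
    by blast
next
  assume "\<exists>i c. H = {x. x $ i = c}"
  then obtain i c where H: "H = {x. x $ i = c}" by blast
  then have H': "H = {x. axis i 1 \<bullet> x = c}" by (simp add: cart_eq_inner_axis inner_commute)
  have "aff_dim H = int (DIM(real ^ 3) - 1)"
    unfolding H' by (rule aff_dim_hyperplane) simp
  moreover have "affine H" unfolding H' by (rule affine_hyperplane)
  moreover have "(\<forall>x\<in>H. \<forall>t. x + t *\<^sub>R axis j 1 \<in> H) \<or>
          (\<forall>x\<in>H. \<forall>y\<in>H. orthogonal (x - y) (axis j 1))" for j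
    by (cases "j = i") (simp_all add: H orthogonal_def inner_axis, simp add: axis_def)
  ultimately show "axis_parallel_plane H"
    by (simp add: axis_parallel_plane_def)
qed

end

theory Submission
  imports Defs
begin

text \<open>
  Lower bound. Count the pairs consisting of a brick \<open>A\<close> of a \<open>k\<close>-slicing partition and a facet of
  the box \<open>B\<close> that \<open>A\<close> meets. Each of the six facet planes meets at least \<open>k\<close> bricks, so there are at
  least \<open>6 k\<close> pairs. In each direction \<open>A\<close> meets 0, 1 or 2 of the two opposite facets; let these
  numbers be \<open>x\<close>, \<open>y\<close>, \<open>z\<close>. Then \<open>A\<close> contributes \<open>x + y + z\<close> pairs, and it contains exactly
  \<open>x y z\<close> of the eight corners of \<open>B\<close>. If \<open>k \<ge> 2\<close>, at most one of the three numbers is 2: a brick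
  that reaches from end to end in two directions is a slab, and a plane through the inside of a slab,
  parallel to it, meets no other brick (\<open>slab_isolates_plane\<close>). For such triples
  \<open>x + y + z \<le> 3 + x y z / 2\<close> and \<open>x y z \<le> 2\<close>. Each corner lies in exactly one brick
  (\<open>corner_in_unique_brick\<close>), so summing over the \<open>N\<close> bricks gives \<open>6 k \<le> 3 N + 4\<close> and \<open>8 \<le> 2 N\<close>. The
  first inequality yields \<open>N \<ge> 2 k - 4/3\<close>, hence \<open>N \<ge> 2 k - 1\<close> by integrality; the second yields \<open>N \<ge> 4\<close>
  (\<open>slicing_lower_bounds\<close>).

  Upper bound. Cut each edge of \<open>B\<close> in two to obtain eight octants. Keep two opposite octants and join
  the other six in pairs to three pairwise skew columns, one for each direction. This pinwheel of five
  bricks is 3-slicing. To raise \<open>k\<close> by 1 at the cost of two bricks, bisect one brick in direction 2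
  and one in direction 1 (\<open>pinwheel_refinement\<close>): bisecting a brick in direction \<open>i\<close> adds 1
  to the count for every plane that meets the brick and is orthogonal to another axis. The
  two bricks are chosen inside the columns of directions 1 and 2, so that every plane meets one
  of them whose bisection counts for it. For \<open>k = 2\<close>, four parallel columns suffice.
\<close>

section \<open>Bricks and axis-parallel planes\<close>

definition meets :: "(real ^ 'n) set \<Rightarrow> 'n \<Rightarrow> real \<Rightarrow> bool" where
  "meets A i c \<longleftrightarrow> A \<inter> {x. x $ i = c} \<noteq> {}"

lemma brick_cboxI: "\<forall>i. l $ i < h $ i \<Longrightarrow> brick (cbox l h)"
  unfolding brick_def by blast

lemma meets_cbox:
  fixes l h :: "real ^ 'n"
  assumes "\<forall>j. l $ j < h $ j"
  shows "meets (cbox l h) i c \<longleftrightarrow> l $ i \<le> c \<and> c \<le> h $ i"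
proof
  assume "meets (cbox l h) i c"
  then show "l $ i \<le> c \<and> c \<le> h $ i"
    by (auto simp: meets_def mem_box_cart)
next
  assume c: "l $ i \<le> c \<and> c \<le> h $ i"
  have "(\<chi> j. if j = i then c else l $ j) \<in> cbox l h \<inter> {x. x $ i = c}"
    using assms c by (auto simp: mem_box_cart less_imp_le)
  then show "meets (cbox l h) i c"
    unfolding meets_def by blast
qed

lemma meets_Un: "meets (A \<union> C) i c \<longleftrightarrow> meets A i c \<or> meets C i c"
  by (auto simp: meets_def)

lemma slicing_3_iff:
  fixes a b :: "real ^ 3"
  assumes "\<forall>i. a $ i < b $ i"
  shows "slicing k (cbox a b) P \<longleftrightarrow> brick_partition (cbox a b) P \<and>
           (\<forall>i c. a $ i \<le> c \<and> c \<le> b $ i \<longrightarrow> k \<le> card {A \<in> P. meets A i c})"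
proof -
  have "{x. x $ i = c} \<inter> cbox a b \<noteq> {} \<longleftrightarrow> a $ i \<le> c \<and> c \<le> b $ i" for i c
    using meets_cbox[OF assms, of i c] by (simp add: meets_def Int_commute)
  then show ?thesis
    unfolding slicing_def axis_parallel_plane_3 meets_def by blast
qed

lemma interior_brick_nonempty:
  fixes A :: "(real ^ 'n) set"
  assumes "brick A" shows "interior A \<noteq> {}"
proof -
  obtain l h where "\<forall>i. l $ i < h $ i" and A: "A = cbox l h"
    using assms by (auto simp: brick_def)
  then have "(\<chi> i. (l $ i + h $ i) / 2) \<in> box l h"
    by (auto simp: mem_box_cart field_simps)
  then show ?thesis
    by (auto simp: A interior_cbox)
qed

text \<open>
  Overlap of bricks can be tested in each coordinate separately. Since the bricks of a partition do not
  overlap, two of them coincide as soon as their intervals overlap in every direction.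
\<close>

lemma bricks_overlap:
  fixes l h l' h' :: "real ^ 'n"
  assumes "\<And>i. max (l $ i) (l' $ i) < min (h $ i) (h' $ i)"
  shows "interior (cbox l h) \<inter> interior (cbox l' h') \<noteq> {}"
proof -
  let ?x = "\<chi> i. (max (l $ i) (l' $ i) + min (h $ i) (h' $ i)) / 2"
  have "?x \<in> box l h \<inter> box l' h'"
    unfolding Int_iff mem_box_cart
  proof (intro conjI allI)
    fix i
    show "l $ i < ?x $ i" "?x $ i < h $ i" "l' $ i < ?x $ i" "?x $ i < h' $ i"
      using assms[of i] by (auto simp: max_def min_def field_simps split: if_splits)
  qed
  then show ?thesis
    by (auto simp: interior_cbox)
qed

lemma brick_partitionE:
  fixes a b :: "real ^ 'n"
  assumes "brick_partition (cbox a b) P" "A \<in> P"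
  obtains l h where "A = cbox l h" "\<And>i. l $ i < h $ i" "\<And>i. a $ i \<le> l $ i" "\<And>i. h $ i \<le> b $ i"
proof -
  obtain l h where lh: "\<forall>i. l $ i < h $ i" and A: "A = cbox l h"
    using assms by (auto simp: brick_partition_def brick_def)
  have "A \<subseteq> cbox a b"
    using assms by (auto simp: brick_partition_def)
  moreover have "l \<in> A" "h \<in> A"
    using lh by (auto simp: A mem_box_cart less_imp_le)
  ultimately have "l \<in> cbox a b" "h \<in> cbox a b"
    by blast+
  then show ?thesis
    using that[of l h] lh A by (auto simp: mem_box_cart)
qed

lemma brick_partition_overlap_eq:
  assumes "brick_partition B P" "A \<in> P" "C \<in> P" "interior A \<inter> interior C \<noteq> {}"
  shows "A = C"
  using assms unfolding brick_partition_def pairwise_def by blast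

section \<open>Faces and corners\<close>

text \<open>
  The corners of \<open>cbox a b\<close> are indexed by choosing one end in each direction, with \<open>True\<close> for the upper
  end \<open>b $ i\<close>. With this index type there are \<open>2 ^ CARD('n)\<close> corners by construction, and the
  corners in a brick form a product of sets of ends.
\<close>

definition corner :: "real ^ 'n \<Rightarrow> real ^ 'n \<Rightarrow> ('n \<Rightarrow> bool) \<Rightarrow> real ^ 'n" where
  "corner a b s = (\<chi> i. if s i then b $ i else a $ i)"

definition ends_met :: "real ^ 'n \<Rightarrow> real ^ 'n \<Rightarrow> (real ^ 'n) set \<Rightarrow> 'n \<Rightarrow> bool set" where
  "ends_met a b A i = {e. meets A i (if e then b $ i else a $ i)}"

lemma corner_mem_iff:
  fixes a b :: "real ^ 'n"
  assumes "brick A"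
  shows "corner a b s \<in> A \<longleftrightarrow> (\<forall>i. s i \<in> ends_met a b A i)"
proof -
  obtain l h where "\<forall>i. l $ i < h $ i" "A = cbox l h"
    using assms by (auto simp: brick_def)
  then show ?thesis
    by (simp add: ends_met_def meets_cbox corner_def mem_box_cart)
qed

lemma card_corners:
  fixes a b :: "real ^ 'n"
  assumes "brick A"
  shows "card {s. corner a b s \<in> A} = (\<Prod>i\<in>UNIV. card (ends_met a b A i))"
proof -
  have "{s. corner a b s \<in> A} = (\<Pi>\<^sub>E i\<in>UNIV. ends_met a b A i)"
    by (auto simp: corner_mem_iff[OF assms] PiE_UNIV_domain)
  then show ?thesis
    by (simp add: card_PiE)
qed

text \<open>
  Existence holds because the partition covers the box. For uniqueness, two bricks that
  contain the same corner both have that corner's coordinate as an end of their interval in every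
  direction and lie on the same side of it, so they overlap.
\<close>

lemma corner_in_unique_brick:
  fixes a b :: "real ^ 'n"
  assumes ab: "\<forall>i. a $ i < b $ i" and P: "brick_partition (cbox a b) P"
  shows "\<exists>!A. A \<in> P \<and> corner a b s \<in> A"
proof -
  have "corner a b s \<in> cbox a b"
    using ab by (auto simp: mem_box_cart corner_def less_imp_le)
  then have ex: "\<exists>A. A \<in> P \<and> corner a b s \<in> A"
    using P by (auto simp: brick_partition_def)
  have "A = C" if "A \<in> P" "C \<in> P" "corner a b s \<in> A" "corner a b s \<in> C" for A C
  proof -
    obtain l h where A: "A = cbox l h"
      and lh: "\<And>i. l $ i < h $ i" "\<And>i. a $ i \<le> l $ i" "\<And>i. h $ i \<le> b $ i"
      using brick_partitionE[OF P \<open>A \<in> P\<close>] by blast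
    obtain l' h' where C: "C = cbox l' h'"
      and lh': "\<And>i. l' $ i < h' $ i" "\<And>i. a $ i \<le> l' $ i" "\<And>i. h' $ i \<le> b $ i"
      using brick_partitionE[OF P \<open>C \<in> P\<close>] by blast
    have "max (l $ i) (l' $ i) < min (h $ i) (h' $ i)" for i
    proof -
      have "l $ i \<le> corner a b s $ i" "corner a b s $ i \<le> h $ i"
        "l' $ i \<le> corner a b s $ i" "corner a b s $ i \<le> h' $ i"
        using that unfolding A C by (simp_all add: mem_box_cart)
      then show ?thesis
        using lh[of i] lh'[of i] by (auto simp: corner_def split: if_splits)
    qed
    from bricks_overlap[of l l' h h', OF this] show ?thesis
      using brick_partition_overlap_eq[OF P that(1,2)] A C by blast
  qed
  with ex show ?thesis
    by blast
qed

lemma sum_corners: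
  fixes a b :: "real ^ 'n"
  assumes ab: "\<forall>i. a $ i < b $ i" and P: "brick_partition (cbox a b) P"
  shows "(\<Sum>A\<in>P. card {s. corner a b s \<in> A}) = 2 ^ CARD('n)"
proof -
  have "card {A \<in> P. corner a b s \<in> A} = 1" for s
  proof -
    obtain A where "A \<in> P" "corner a b s \<in> A" "\<And>C. C \<in> P \<Longrightarrow> corner a b s \<in> C \<Longrightarrow> C = A"
      using corner_in_unique_brick[OF ab P, of s] by blast
    then have "{A \<in> P. corner a b s \<in> A} = {A}"
      by blast
    then show ?thesis
      by simp
  qed
  then have "(\<Sum>A\<in>P. card {s \<in> UNIV. corner a b s \<in> A}) = 1 * card (UNIV :: ('n \<Rightarrow> bool) set)"
    using P by (intro sum_multicount) (auto simp: brick_partition_def)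
  then show ?thesis
    by (simp add: card_fun)
qed

text \<open>
  The sum counts incidences between bricks and facets of the box; there are \<open>2 * CARD('n)\<close>
  facets, and at least \<open>k\<close> bricks meet each of them.
\<close>

lemma sum_ends_met_ge:
  fixes a b :: "real ^ 'n"
  assumes "finite P"
    and "\<And>i. k \<le> card {A \<in> P. meets A i (a $ i)}" "\<And>i. k \<le> card {A \<in> P. meets A i (b $ i)}"
  shows "2 * k * CARD('n) \<le> (\<Sum>A\<in>P. \<Sum>i\<in>UNIV. card (ends_met a b A i))"
proof -
  have "2 * k \<le> (\<Sum>A\<in>P. card (ends_met a b A i))" for i
  proof -
    have "2 * k \<le> (\<Sum>e\<in>UNIV. card {A \<in> P. e \<in> ends_met a b A i})"
      using assms(2,3)[of i] by (simp add: UNIV_bool ends_met_def)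
    also have "\<dots> = (\<Sum>A\<in>P. card {e \<in> UNIV. e \<in> ends_met a b A i})"
      using assms(1) by (intro sum_multicount_gen[symmetric]) auto
    finally show ?thesis
      by simp
  qed
  then have "(\<Sum>i\<in>(UNIV :: 'n set). 2 * k) \<le> (\<Sum>i\<in>UNIV. \<Sum>A\<in>P. card (ends_met a b A i))"
    by (intro sum_mono)
  then show ?thesis
    by (subst sum.swap) (simp add: mult_ac)
qed

section \<open>The lower bound\<close>

lemma card_ends_met_le: "card (ends_met a b A i) \<le> 2"
  using card_mono[of UNIV "ends_met a b A i"] by (simp add: card_UNIV_bool)

text \<open>
  A brick \<open>A\<close> that reaches from end to end in all directions but \<open>m\<close> fills the whole cross-section of the
  box. Another brick that meets the plane halfway through \<open>A\<close> would have to enter the interior of \<open>A\<close>.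
\<close>

lemma slab_isolates_plane:
  fixes a b :: "real ^ 'n"
  assumes P: "brick_partition (cbox a b) P" and A: "A \<in> P"
    and spans: "\<And>i. i \<noteq> m \<Longrightarrow> card (ends_met a b A i) = 2"
  obtains c where "a $ m \<le> c" "c \<le> b $ m" "{C \<in> P. meets C m c} \<subseteq> {A}"
proof -
  obtain l h where Alh: "A = cbox l h"
    and lh: "\<And>i. l $ i < h $ i" "\<And>i. a $ i \<le> l $ i" "\<And>i. h $ i \<le> b $ i"
    using brick_partitionE[OF P A] by blast
  have full: "l $ i \<le> a $ i \<and> b $ i \<le> h $ i" if "i \<noteq> m" for i
  proof -
    have "ends_met a b A i = UNIV"
      using spans[OF that] by (intro card_subset_eq) (auto simp: card_UNIV_bool)
    then have "meets A i (a $ i)" "meets A i (b $ i)"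
      by (auto simp: ends_met_def set_eq_iff split: if_splits)
    then show ?thesis
      using lh(1) by (simp add: Alh meets_cbox)
  qed
  let ?c = "(l $ m + h $ m) / 2"
  have "C = A" if C: "C \<in> P" "meets C m ?c" for C
  proof -
    obtain l' h' where Clh: "C = cbox l' h'"
      and lh': "\<And>i. l' $ i < h' $ i" "\<And>i. a $ i \<le> l' $ i" "\<And>i. h' $ i \<le> b $ i"
      using brick_partitionE[OF P C(1)] by blast
    have c: "l' $ m \<le> ?c" "?c \<le> h' $ m"
      using C(2) lh'(1) by (simp_all add: Clh meets_cbox)
    have "max (l' $ i) (l $ i) < min (h' $ i) (h $ i)" for i
    proof (cases "i = m")
      case True
      then show ?thesis
        using c lh(1)[of m] lh'(1)[of m] by auto
    next
      case False
      then show ?thesis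
        using full[OF False] lh[of i] lh'[of i] by auto
    qed
    from bricks_overlap[of l' l h' h, OF this] show ?thesis
      using brick_partition_overlap_eq[OF P C(1) A] Alh Clh by blast
  qed
  then show ?thesis
    using lh[of m] by (intro that[of ?c]) auto
qed

lemma slicing_spans_at_most_once:
  fixes a b :: "real ^ 3"
  assumes ab: "\<forall>i. a $ i < b $ i" and S: "slicing k (cbox a b) P" and k: "2 \<le> k"
    and A: "A \<in> P" and ij: "i \<noteq> j"
  shows "card (ends_met a b A i) \<le> 1 \<or> card (ends_met a b A j) \<le> 1"
proof (rule ccontr)
  assume "\<not> ?thesis"
  then have two: "card (ends_met a b A i) = 2" "card (ends_met a b A j) = 2"
    using card_ends_met_le[of a b A i] card_ends_met_le[of a b A j] by linarith+
  have P: "brick_partition (cbox a b) P"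
    using S by (simp add: slicing_def)
  have "card (UNIV - {i, j}) = 1"
    using ij by (simp add: card_Diff_subset)
  then obtain m where "UNIV - {i, j} = {m}"
    by (auto simp: card_1_singleton_iff)
  then have "n = i \<or> n = j" if "n \<noteq> m" for n
    using that by blast
  then have "card (ends_met a b A n) = 2" if "n \<noteq> m" for n
    using two that by blast
  then obtain c where c: "a $ m \<le> c" "c \<le> b $ m" "{C \<in> P. meets C m c} \<subseteq> {A}"
    using slab_isolates_plane[OF P A] by blast
  have "k \<le> card {C \<in> P. meets C m c}"
    using S c(1,2) by (simp add: slicing_3_iff[OF ab])
  also have "\<dots> \<le> 1"
    using card_mono[OF _ c(3)] by simp
  finally show False
    using k by simp
qed

lemma prod_UNIV_3: "prod f (UNIV :: 3 set) = f 1 * f 2 * f 3"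
  unfolding UNIV_3 by (simp add: ac_simps)

text \<open>
  Allowing at most one 2 excludes \<open>(2, 2, 0)\<close>, for which the first bound fails, and
  \<open>(2, 2, 1)\<close> and \<open>(2, 2, 2)\<close>, for which the second one fails. Equality occurs in both
  for \<open>(2, 1, 1)\<close>, the column along an edge of the box.
\<close>

lemma end_counts_ineq:
  fixes x y z :: nat
  assumes "x \<le> 2" "y \<le> 2" "z \<le> 2" "x \<le> 1 \<or> y \<le> 1" "y \<le> 1 \<or> z \<le> 1" "x \<le> 1 \<or> z \<le> 1"
  shows "2 * (x + y + z) \<le> 6 + x * y * z" "x * y * z \<le> 2"
proof -
  have "x \<in> {0,1,2}" "y \<in> {0,1,2}" "z \<in> {0,1,2}"
    using assms by auto
  then have "2 * (x + y + z) \<le> 6 + x * y * z \<and> x * y * z \<le> 2"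
    using assms(4-6) by (elim insertE emptyE; hypsubst; simp)
  then show "2 * (x + y + z) \<le> 6 + x * y * z" "x * y * z \<le> 2"
    by simp_all
qed

lemma slicing_lower_bounds:
  fixes B :: "(real ^ 3) set"
  assumes "brick B" and S: "slicing k B P" and k: "2 \<le> k"
  shows "2 * k - 1 \<le> card P" "4 \<le> card P"
proof -
  obtain a b where ab: "\<forall>i. a $ i < b $ i" and B: "B = cbox a b"
    using \<open>brick B\<close> by (auto simp: brick_def)
  have P: "brick_partition (cbox a b) P" and S': "slicing k (cbox a b) P"
    using S by (simp_all add: slicing_def B)
  define t where "t = (\<lambda>A i. card (ends_met a b A i))"
  have per_brick: "2 * (\<Sum>i\<in>UNIV. t A i) \<le> 6 + card {s. corner a b s \<in> A}"
      "card {s. corner a b s \<in> A} \<le> 2" if A: "A \<in> P" for A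
  proof -
    have "brick A"
      using P A by (auto simp: brick_partition_def)
    then show "2 * (\<Sum>i\<in>UNIV. t A i) \<le> 6 + card {s. corner a b s \<in> A}"
      "card {s. corner a b s \<in> A} \<le> 2"
      using end_counts_ineq[of "t A 1" "t A 2" "t A 3"] card_ends_met_le[of a b A]
        slicing_spans_at_most_once[OF ab S' k A, of 1 2]
        slicing_spans_at_most_once[OF ab S' k A, of 2 3]
        slicing_spans_at_most_once[OF ab S' k A, of 1 3]
      unfolding t_def by (simp_all add: card_corners sum_3 prod_UNIV_3)
  qed
  \<comment> \<open>The eight corners bound the total excess of the bricks over three facets each.\<close>
  have corners: "(\<Sum>A\<in>P. card {s. corner a b s \<in> A}) = 8"
    using sum_corners[OF ab P] by simp
  have "(\<Sum>A\<in>P. card {s. corner a b s \<in> A}) \<le> (\<Sum>A\<in>P. 2)"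
    using per_brick(2) by (rule sum_mono)
  then show "4 \<le> card P"
    unfolding corners by simp
  have "2 * k * 3 \<le> (\<Sum>A\<in>P. \<Sum>i\<in>UNIV. t A i)"
    using sum_ends_met_ge[of P k a b] S' ab
    by (simp add: slicing_3_iff brick_partition_def less_imp_le t_def)
  then have "2 * (2 * k * 3) \<le> (\<Sum>A\<in>P. 2 * (\<Sum>i\<in>UNIV. t A i))"
    by (simp add: sum_distrib_left[symmetric])
  also have "\<dots> \<le> (\<Sum>A\<in>P. 6 + card {s. corner a b s \<in> A})"
    using per_brick(1) by (rule sum_mono)
  also have "\<dots> = 6 * card P + 8"
    using corners by (simp add: sum.distrib)
  finally show "2 * k - 1 \<le> card P"
    by linarith
qed

section \<open>Bisecting a brick\<close>

lemma bisect_brick: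
  fixes A :: "(real ^ 'n) set" and i :: 'n
  assumes "brick A"
  obtains A1 A2 where "brick A1" "brick A2" "A = A1 \<union> A2" "interior A1 \<inter> interior A2 = {}"
    "\<And>j c. j \<noteq> i \<Longrightarrow> meets A1 j c \<longleftrightarrow> meets A j c" "\<And>j c. j \<noteq> i \<Longrightarrow> meets A2 j c \<longleftrightarrow> meets A j c"
proof -
  obtain l h where lh: "\<forall>i. l $ i < h $ i" and A: "A = cbox l h"
    using assms by (auto simp: brick_def)
  define m where "m = (l $ i + h $ i) / 2"
  define u where "u = (\<chi> j. if j = i then m else h $ j)"
  define v where "v = (\<chi> j. if j = i then m else l $ j)"
  have m: "l $ i < m" "m < h $ i"
    using lh by (auto simp: m_def field_simps)
  have u: "\<forall>j. l $ j < u $ j" and v: "\<forall>j. v $ j < h $ j"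
    using lh m by (auto simp: u_def v_def)
  show ?thesis
  proof
    show "brick (cbox l u)" "brick (cbox v h)"
      using u v by (simp_all add: brick_cboxI)
    show "A = cbox l u \<union> cbox v h"
    proof (rule set_eqI)
      fix x :: "real ^ 'n"
      have mem_cbox: "x \<in> cbox p q \<longleftrightarrow>
          (p $ i \<le> x $ i \<and> x $ i \<le> q $ i) \<and> (\<forall>j. j \<noteq> i \<longrightarrow> p $ j \<le> x $ j \<and> x $ j \<le> q $ j)" for p q
        unfolding mem_box_cart by metis
      show "x \<in> A \<longleftrightarrow> x \<in> cbox l u \<union> cbox v h"
        unfolding A Un_iff mem_cbox using m by (auto simp: u_def v_def)
    qed
    show "interior (cbox l u) \<inter> interior (cbox v h) = {}"
    proof -
      have "x $ i < m" if "x \<in> box l u" for x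
        using that[unfolded mem_box_cart, rule_format, of i] by (simp add: u_def)
      moreover have "m < x $ i" if "x \<in> box v h" for x
        using that[unfolded mem_box_cart, rule_format, of i] by (simp add: v_def)
      ultimately show ?thesis
        unfolding interior_cbox by (meson disjoint_iff less_asym)
    qed
    show "meets (cbox l u) j c \<longleftrightarrow> meets A j c" "meets (cbox v h) j c \<longleftrightarrow> meets A j c" if "j \<noteq> i" for j c
      using that unfolding A meets_cbox[OF u] meets_cbox[OF v] meets_cbox[OF lh]
      by (simp_all add: u_def v_def)
  qed
qed

text \<open>
  The halves of \<open>A\<close> have the same extent as \<open>A\<close> in all directions but \<open>i\<close>; hence a plane
  orthogonal to another axis that meets \<open>A\<close> meets both of them. A plane orthogonal to axis \<open>i\<close> that meets
  \<open>A\<close> still meets one of them, so no count decreases. One half is recorded as new and with its extent,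
  so that it can take the place of \<open>A\<close> in the next bisection.
\<close>

lemma bisect_in_partition:
  fixes P :: "(real ^ 'n) set set" and i :: 'n
  assumes P: "brick_partition B P" and A: "A \<in> P"
  shows "\<exists>A1 A2 Q. Q = insert A1 (insert A2 (P - {A})) \<and> A = A1 \<union> A2 \<and> A1 \<notin> P \<and>
    brick_partition B Q \<and> card Q = card P + 1 \<and>
    (\<forall>j c. j \<noteq> i \<longrightarrow> meets A1 j c = meets A j c) \<and>
    (\<forall>j c. card {C \<in> P. meets C j c} \<le> card {C \<in> Q. meets C j c}) \<and>
    (\<forall>j c. j \<noteq> i \<longrightarrow> meets A j c \<longrightarrow> card {C \<in> P. meets C j c} + 1 \<le> card {C \<in> Q. meets C j c})"
proof -
  have "brick A" and fin: "finite P" and bricks: "\<And>C. C \<in> P \<Longrightarrow> brick C"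
    and disj: "\<And>C D. C \<in> P \<Longrightarrow> D \<in> P \<Longrightarrow> C \<noteq> D \<Longrightarrow> interior C \<inter> interior D = {}"
    using P A by (auto simp: brick_partition_def pairwise_def)
  obtain A1 A2 where b: "brick A1" "brick A2" and un: "A = A1 \<union> A2"
    and d12: "interior A1 \<inter> interior A2 = {}"
    and m1: "\<And>j c. j \<noteq> i \<Longrightarrow> meets A1 j c \<longleftrightarrow> meets A j c"
    and m2: "\<And>j c. j \<noteq> i \<Longrightarrow> meets A2 j c \<longleftrightarrow> meets A j c"
    using bisect_brick[OF \<open>brick A\<close>, of i] by metis
  have ne: "interior A1 \<noteq> {}" "interior A2 \<noteq> {}"
    using b interior_brick_nonempty by blast+
  have sub: "interior A1 \<subseteq> interior A" "interior A2 \<subseteq> interior A"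
    by (simp_all add: un interior_mono)
  have neq: "A1 \<noteq> A2"
    using d12 ne by auto
  have new: "A1 \<notin> P" "A2 \<notin> P"
  proof -
    have "A1 \<noteq> A" "A2 \<noteq> A"
      using d12 ne sub by blast+
    then show "A1 \<notin> P" "A2 \<notin> P"
      using disj[OF A, of A1] disj[OF A, of A2] ne sub by blast+
  qed
  let ?Q = "insert A1 (insert A2 (P - {A}))"
  have part: "brick_partition B ?Q"
    unfolding brick_partition_def
  proof (intro conjI)
    show "finite ?Q"
      using fin by simp
    show "\<forall>C\<in>?Q. brick C"
      using b bricks by auto
    have "\<Union> P = B"
      using P by (simp add: brick_partition_def)
    then show "\<Union> ?Q = B"
      using A un by blast
    have "interior A1 \<inter> interior C = {}" "interior A2 \<inter> interior C = {}" if "C \<in> P - {A}" for C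
      using disj[OF A, of C] that sub by blast+
    then show "pairwise (\<lambda>A C. interior A \<inter> interior C = {}) ?Q"
      using d12 disj unfolding pairwise_insert by (auto simp: pairwise_def Int_commute)
  qed
  have card: "card ?Q = card P + 1"
    using new neq fin card_Suc_Diff1[OF fin A] by (simp del: card_Diff_insert card_Diff_singleton)
  have rest: "{C \<in> P. meets C j c} = {C \<in> P - {A}. meets C j c} \<union> (if meets A j c then {A} else {})" for j c
    using A by auto
  have count: "card {C \<in> P. meets C j c} = card {C \<in> P - {A}. meets C j c} + (if meets A j c then 1 else 0)" for j c
    unfolding rest[of j c] using fin by (subst card_Un_disjoint) auto
  have "{C \<in> ?Q. meets C j c} = {C \<in> P - {A}. meets C j c} \<union>
      ((if meets A1 j c then {A1} else {}) \<union> (if meets A2 j c then {A2} else {}))" for j c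
    by auto
  then have countQ: "card {C \<in> ?Q. meets C j c} = card {C \<in> P - {A}. meets C j c} +
      ((if meets A1 j c then 1 else 0) + (if meets A2 j c then 1 else 0))" for j c
    using fin new neq by (simp add: card_Un_disjoint)
  have ge: "card {C \<in> P. meets C j c} \<le> card {C \<in> ?Q. meets C j c}" for j c
    using meets_Un[of A1 A2 j c] unfolding count countQ un[symmetric] by auto
  have gt: "card {C \<in> P. meets C j c} + 1 \<le> card {C \<in> ?Q. meets C j c}" if "j \<noteq> i" "meets A j c" for j c
    unfolding count countQ using m1 m2 that by auto
  show ?thesis
    using un new(1) part card m1 ge gt by (intro exI[of _ ?Q] exI[of _ A1] exI[of _ A2]) blast
qed

section \<open>Partitions of minimum size\<close>

text \<open>
  Bisecting the whole box in direction 2 and then both halves in direction 3 gives four columns in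
  direction 1. The first bisection serves the planes orthogonal to axes 1 and 3; a plane orthogonal to axis 2
  meets one of the halves, and is served when that half is bisected.
\<close>

lemma slicing_2_example:
  fixes B :: "(real ^ 3) set"
  assumes "brick B"
  shows "\<exists>P. slicing 2 B P \<and> card P = 4"
proof -
  obtain a b where ab: "\<forall>i. a $ i < b $ i" and B: "B = cbox a b"
    using assms by (auto simp: brick_def)
  have meets_B: "meets B i c \<longleftrightarrow> a $ i \<le> c \<and> c \<le> b $ i" for i c
    by (simp add: B meets_cbox[OF ab])
  have P: "brick_partition B {B}"
    using assms by (auto simp: brick_partition_def)
  obtain A1 A2 Q where Q: "Q = insert A1 (insert A2 ({B} - {B}))" "B = A1 \<union> A2"
      "brick_partition B Q" "card Q = card {B} + 1"
    and Q_ge: "\<And>j c. card {C \<in> {B}. meets C j c} \<le> card {C \<in> Q. meets C j c}"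
    and Q_gt: "\<And>j c. j \<noteq> 2 \<Longrightarrow> meets B j c \<Longrightarrow>
       card {C \<in> {B}. meets C j c} + 1 \<le> card {C \<in> Q. meets C j c}"
    using bisect_in_partition[OF P singletonI, of 2] by blast
  have "A1 \<in> Q" "A2 \<in> Q" "A1 \<noteq> A2"
    using Q by auto
  obtain A3 A4 R where R: "R = insert A3 (insert A4 (Q - {A1}))"
      "brick_partition B R" "card R = card Q + 1"
    and R_ge: "\<And>j c. card {C \<in> Q. meets C j c} \<le> card {C \<in> R. meets C j c}"
    and R_gt: "\<And>j c. j \<noteq> 3 \<Longrightarrow> meets A1 j c \<Longrightarrow>
       card {C \<in> Q. meets C j c} + 1 \<le> card {C \<in> R. meets C j c}"
    using bisect_in_partition[OF Q(3) \<open>A1 \<in> Q\<close>, of 3] by blast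
  have "A2 \<in> R"
    using R(1) \<open>A2 \<in> Q\<close> \<open>A1 \<noteq> A2\<close> by auto
  obtain S where S: "brick_partition B S" "card S = card R + 1"
    and S_ge: "\<And>j c. card {C \<in> R. meets C j c} \<le> card {C \<in> S. meets C j c}"
    and S_gt: "\<And>j c. j \<noteq> 3 \<Longrightarrow> meets A2 j c \<Longrightarrow>
       card {C \<in> R. meets C j c} + 1 \<le> card {C \<in> S. meets C j c}"
    using bisect_in_partition[OF R(2) \<open>A2 \<in> R\<close>, of 3] by blast
  have "2 \<le> card {C \<in> S. meets C j c}" if "a $ j \<le> c \<and> c \<le> b $ j" for j c
  proof -
    have B_met: "meets B j c"
      using that by (simp add: meets_B)
    then have "{C \<in> {B}. meets C j c} = {B}"
      by auto
    then have one: "card {C \<in> {B}. meets C j c} = 1"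
      by simp
    show ?thesis
    proof (cases "j = 2")
      case False
      then show ?thesis
        using Q_gt[OF False B_met] R_ge[of j c] S_ge[of j c] one by linarith
    next
      case True
      then have "j \<noteq> 3"
        by simp
      moreover have "meets A1 j c \<or> meets A2 j c"
        using B_met Q(2) by (simp add: meets_Un)
      ultimately show ?thesis
        using Q_ge[of j c] R_gt[of j c] R_ge[of j c] S_gt[of j c] S_ge[of j c] one by linarith
    qed
  qed
  then have "slicing 2 B S"
    using S(1) by (simp add: B slicing_3_iff[OF ab])
  moreover have "card S = 4"
    using S(2) R(3) Q(4) by simp
  ultimately show ?thesis
    by blast
qed

text \<open>
  The bricks \<open>A\<close>, \<open>C\<close>, \<open>E\<close> of the proof are the columns in directions 1, 2, 3; \<open>F\<close> and \<open>G\<close> are the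
  octants at the corners \<open>a\<close> and \<open>b\<close>. In each direction, every plane below \<open>m\<close> meets the column in that
  direction, one more column and \<open>F\<close>, and every plane above \<open>m\<close> meets that column, the other
  column and \<open>G\<close>. The last four parts of the conclusion say that \<open>A\<close> or \<open>C\<close> can be used for every plane
  in the refinement that follows.
\<close>

lemma pinwheel:
  fixes a b m :: "real ^ 3"
  assumes am: "\<forall>i. a $ i < m $ i" and mb: "\<forall>i. m $ i < b $ i"
  shows "\<exists>P A C. brick_partition (cbox a b) P \<and> card P = 5 \<and>
    (\<forall>i c. a $ i \<le> c \<and> c \<le> b $ i \<longrightarrow> 3 \<le> card {D \<in> P. meets D i c}) \<and>
    A \<in> P \<and> C \<in> P \<and> A \<noteq> C \<and>
    (\<forall>c. a $ 1 \<le> c \<and> c \<le> b $ 1 \<longrightarrow> meets A 1 c) \<and> (\<forall>c. m $ 3 \<le> c \<and> c \<le> b $ 3 \<longrightarrow> meets A 3 c) \<and>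
    (\<forall>c. a $ 2 \<le> c \<and> c \<le> b $ 2 \<longrightarrow> meets C 2 c) \<and> (\<forall>c. a $ 3 \<le> c \<and> c \<le> m $ 3 \<longrightarrow> meets C 3 c)"
proof -
  define Al Ah Cl Ch El Eh :: "real ^ 3"
    where corners: "Al = vector [a $ 1, a $ 2, m $ 3]" "Ah = vector [b $ 1, m $ 2, b $ 3]"
      "Cl = vector [m $ 1, a $ 2, a $ 3]" "Ch = vector [b $ 1, b $ 2, m $ 3]"
      "El = vector [a $ 1, m $ 2, a $ 3]" "Eh = vector [m $ 1, b $ 2, b $ 3]"
  define A where "A = cbox Al Ah"
  define C where "C = cbox Cl Ch"
  define E where "E = cbox El Eh"
  define F where "F = cbox a m"
  define G where "G = cbox m b"
  have am3: "a $ 1 < m $ 1" "a $ 2 < m $ 2" "a $ 3 < m $ 3"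
    and mb3: "m $ 1 < b $ 1" "m $ 2 < b $ 2" "m $ 3 < b $ 3"
    using am mb by auto
  note ord = am3 mb3 less_trans[OF am3(1) mb3(1)] less_trans[OF am3(2) mb3(2)] less_trans[OF am3(3) mb3(3)]
  have A: "\<forall>i. Al $ i < Ah $ i" and C: "\<forall>i. Cl $ i < Ch $ i" and E: "\<forall>i. El $ i < Eh $ i"
    using ord by (simp_all add: corners forall_3)
  have bricks: "brick A" "brick C" "brick E" "brick F" "brick G"
    using A C E am mb by (simp_all add: A_def C_def E_def F_def G_def brick_cboxI)
  have meets_A: "meets A 1 c \<longleftrightarrow> a $ 1 \<le> c \<and> c \<le> b $ 1" "meets A 2 c \<longleftrightarrow> a $ 2 \<le> c \<and> c \<le> m $ 2"
      "meets A 3 c \<longleftrightarrow> m $ 3 \<le> c \<and> c \<le> b $ 3" for c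
    unfolding A_def meets_cbox[OF A] by (simp_all add: corners)
  have meets_C: "meets C 1 c \<longleftrightarrow> m $ 1 \<le> c \<and> c \<le> b $ 1" "meets C 2 c \<longleftrightarrow> a $ 2 \<le> c \<and> c \<le> b $ 2"
      "meets C 3 c \<longleftrightarrow> a $ 3 \<le> c \<and> c \<le> m $ 3" for c
    unfolding C_def meets_cbox[OF C] by (simp_all add: corners)
  have meets_E: "meets E 1 c \<longleftrightarrow> a $ 1 \<le> c \<and> c \<le> m $ 1" "meets E 2 c \<longleftrightarrow> m $ 2 \<le> c \<and> c \<le> b $ 2"
      "meets E 3 c \<longleftrightarrow> a $ 3 \<le> c \<and> c \<le> b $ 3" for c
    unfolding E_def meets_cbox[OF E] by (simp_all add: corners)
  have meets_F: "meets F i c \<longleftrightarrow> a $ i \<le> c \<and> c \<le> m $ i" for i c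
    unfolding F_def by (rule meets_cbox[OF am])
  have meets_G: "meets G i c \<longleftrightarrow> m $ i \<le> c \<and> c \<le> b $ i" for i c
    unfolding G_def by (rule meets_cbox[OF mb])
  have disj: "interior A \<inter> interior C = {}" "interior A \<inter> interior E = {}" "interior A \<inter> interior F = {}"
    "interior A \<inter> interior G = {}" "interior C \<inter> interior E = {}" "interior C \<inter> interior F = {}"
    "interior C \<inter> interior G = {}" "interior E \<inter> interior F = {}" "interior E \<inter> interior G = {}"
    "interior F \<inter> interior G = {}"
    unfolding A_def C_def E_def F_def G_def interior_cbox disjoint_iff mem_box_cart forall_3 corners vector_3
    by (auto dest: less_trans)
  have neq: "X \<noteq> Y" if "brick X" "interior X \<inter> interior Y = {}" for X Y :: "(real ^ 3) set"
    using interior_brick_nonempty[OF that(1)] that(2) by blast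
  have distinct: "A \<noteq> C" "A \<noteq> E" "A \<noteq> F" "A \<noteq> G" "C \<noteq> E" "C \<noteq> F" "C \<noteq> G" "E \<noteq> F" "E \<noteq> G" "F \<noteq> G"
    using neq[OF bricks(1) disj(1)] neq[OF bricks(1) disj(2)] neq[OF bricks(1) disj(3)]
      neq[OF bricks(1) disj(4)] neq[OF bricks(2) disj(5)] neq[OF bricks(2) disj(6)]
      neq[OF bricks(2) disj(7)] neq[OF bricks(3) disj(8)] neq[OF bricks(3) disj(9)]
      neq[OF bricks(4) disj(10)] by blast+
  let ?P = "{A, C, E, F, G}"
  have union: "A \<union> C \<union> E \<union> F \<union> G = cbox a b"
  proof (intro equalityI subsetI)
    fix x
    assume "x \<in> A \<union> C \<union> E \<union> F \<union> G"
    then show "x \<in> cbox a b"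
      using ord unfolding A_def C_def E_def F_def G_def Un_iff mem_box_cart forall_3 corners vector_3
      by (elim disjE) simp_all
  next
    fix x
    assume "x \<in> cbox a b"
    then show "x \<in> A \<union> C \<union> E \<union> F \<union> G"
      unfolding A_def C_def E_def F_def G_def Un_iff mem_box_cart forall_3 corners vector_3
      by (cases "x $ 1 \<le> m $ 1"; cases "x $ 2 \<le> m $ 2"; cases "x $ 3 \<le> m $ 3") simp_all
  qed
  have part: "brick_partition (cbox a b) ?P"
    unfolding brick_partition_def
  proof (intro conjI)
    show "pairwise (\<lambda>A C. interior A \<inter> interior C = {}) ?P"
    proof (rule pairwiseI)
      fix X Y
      assume "X \<in> ?P" "Y \<in> ?P" "X \<noteq> Y"
      then show "interior X \<inter> interior Y = {}"
        using disj unfolding insert_iff empty_iff by (elim disjE) (simp_all add: Int_commute)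
    qed
    show "\<Union> ?P = cbox a b"
      using union by (simp add: Un_assoc)
  qed (use bricks in simp_all)
  have three: "3 \<le> card {D \<in> ?P. meets D i c}"
    if "X \<in> ?P" "Y \<in> ?P" "Z \<in> ?P" "X \<noteq> Y" "X \<noteq> Z" "Y \<noteq> Z" "meets X i c" "meets Y i c" "meets Z i c"
    for X Y Z i c
  proof -
    have "card {X, Y, Z} \<le> card {D \<in> ?P. meets D i c}"
      using that(1-3,7-9) by (intro card_mono) auto
    then show ?thesis
      using that(4-6) by simp
  qed
  have count: "3 \<le> card {D \<in> ?P. meets D i c}" if c: "a $ i \<le> c" "c \<le> b $ i" for i c
  proof (cases "c \<le> m $ i")
    case True
    consider "i = 1" | "i = 2" | "i = 3"
      using exhaust_3 by blast
    then show ?thesis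
    proof cases
      case 1
      then show ?thesis
        using c True distinct by (intro three[of A E F]) (auto simp: meets_A meets_E meets_F)
    next
      case 2
      then show ?thesis
        using c True distinct by (intro three[of A C F]) (auto simp: meets_A meets_C meets_F)
    next
      case 3
      then show ?thesis
        using c True distinct by (intro three[of C E F]) (auto simp: meets_C meets_E meets_F)
    qed
  next
    case False
    consider "i = 1" | "i = 2" | "i = 3"
      using exhaust_3 by blast
    then show ?thesis
    proof cases
      case 1
      then show ?thesis
        using c False distinct by (intro three[of A C G]) (auto simp: meets_A meets_C meets_G)
    next
      case 2
      then show ?thesis
        using c False distinct by (intro three[of C E G]) (auto simp: meets_C meets_E meets_G)
    next
      case 3
      then show ?thesis
        using c False distinct by (intro three[of A E G]) (auto simp: meets_A meets_E meets_G)
    qed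
  qed
  show ?thesis
  proof (rule exI[of _ ?P], rule exI[of _ A], rule exI[of _ C], intro conjI allI impI)
    show "card ?P = 5"
      using distinct by simp
    show "3 \<le> card {D \<in> ?P. meets D i c}" if "a $ i \<le> c \<and> c \<le> b $ i" for i c
      using count that by blast
  qed (use part distinct(1) in \<open>simp_all add: meets_A meets_C\<close>)
qed

text \<open>
  Bisecting \<open>A\<close> in direction 2 serves all planes orthogonal to axis 1 and the upper ones orthogonal
  to axis 3; bisecting \<open>C\<close> in direction 1 serves all planes orthogonal to axis 2 and the
  lower ones orthogonal to axis 3. Either step leaves a half with the same extent in the relevant
  directions, which keeps the induction going.
\<close>

lemma pinwheel_refinement:
  fixes a b m :: "real ^ 3"
  assumes am: "\<forall>i. a $ i < m $ i" and mb: "\<forall>i. m $ i < b $ i"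
  shows "\<exists>P A C. brick_partition (cbox a b) P \<and> card P = 2 * n + 5 \<and>
    (\<forall>i c. a $ i \<le> c \<and> c \<le> b $ i \<longrightarrow> n + 3 \<le> card {D \<in> P. meets D i c}) \<and>
    A \<in> P \<and> C \<in> P \<and> A \<noteq> C \<and>
    (\<forall>c. a $ 1 \<le> c \<and> c \<le> b $ 1 \<longrightarrow> meets A 1 c) \<and> (\<forall>c. m $ 3 \<le> c \<and> c \<le> b $ 3 \<longrightarrow> meets A 3 c) \<and>
    (\<forall>c. a $ 2 \<le> c \<and> c \<le> b $ 2 \<longrightarrow> meets C 2 c) \<and> (\<forall>c. a $ 3 \<le> c \<and> c \<le> m $ 3 \<longrightarrow> meets C 3 c)"
proof (induction n)
  case 0
  show ?case
    using pinwheel[OF am mb] by simp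
next
  case (Suc n)
  then obtain P A C where P: "brick_partition (cbox a b) P" "card P = 2 * n + 5"
    and P_ge: "\<forall>i c. a $ i \<le> c \<and> c \<le> b $ i \<longrightarrow> n + 3 \<le> card {D \<in> P. meets D i c}"
    and AC: "A \<in> P" "C \<in> P" "A \<noteq> C"
    and mA: "\<forall>c. a $ 1 \<le> c \<and> c \<le> b $ 1 \<longrightarrow> meets A 1 c" "\<forall>c. m $ 3 \<le> c \<and> c \<le> b $ 3 \<longrightarrow> meets A 3 c"
    and mC: "\<forall>c. a $ 2 \<le> c \<and> c \<le> b $ 2 \<longrightarrow> meets C 2 c" "\<forall>c. a $ 3 \<le> c \<and> c \<le> m $ 3 \<longrightarrow> meets C 3 c"
    by (elim exE conjE) (rule that)
  obtain A1 A2 Q where Q: "Q = insert A1 (insert A2 (P - {A}))" "A1 \<notin> P"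
      "brick_partition (cbox a b) Q" "card Q = card P + 1"
    and A1: "\<And>j c. j \<noteq> 2 \<Longrightarrow> meets A1 j c \<longleftrightarrow> meets A j c"
    and Q_ge: "\<And>j c. card {D \<in> P. meets D j c} \<le> card {D \<in> Q. meets D j c}"
    and Q_gt: "\<And>j c. j \<noteq> 2 \<Longrightarrow> meets A j c \<Longrightarrow> card {D \<in> P. meets D j c} + 1 \<le> card {D \<in> Q. meets D j c}"
    using bisect_in_partition[OF P(1) AC(1), of 2] by blast
  have "C \<in> Q" "A1 \<in> Q" "A1 \<noteq> C"
    using Q(1,2) AC by auto
  obtain C1 C2 R where R: "R = insert C1 (insert C2 (Q - {C}))" "C1 \<notin> Q"
      "brick_partition (cbox a b) R" "card R = card Q + 1"
    and C1: "\<And>j c. j \<noteq> 1 \<Longrightarrow> meets C1 j c \<longleftrightarrow> meets C j c"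
    and R_ge: "\<And>j c. card {D \<in> Q. meets D j c} \<le> card {D \<in> R. meets D j c}"
    and R_gt: "\<And>j c. j \<noteq> 1 \<Longrightarrow> meets C j c \<Longrightarrow> card {D \<in> Q. meets D j c} + 1 \<le> card {D \<in> R. meets D j c}"
    using bisect_in_partition[OF Q(3) \<open>C \<in> Q\<close>, of 1] by blast
  have "A1 \<in> R" "C1 \<in> R" "A1 \<noteq> C1"
    using R(1,2) \<open>A1 \<in> Q\<close> \<open>A1 \<noteq> C\<close> by auto
  have "card R = 2 * Suc n + 5"
    using P(2) Q(4) R(4) by simp
  have count: "Suc n + 3 \<le> card {D \<in> R. meets D i c}" if c: "a $ i \<le> c \<and> c \<le> b $ i" for i c
  proof -
    consider "i = 1" | "i = 2" | "i = 3" "m $ 3 \<le> c" | "i = 3" "c \<le> m $ 3"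
      using exhaust_3[of i] linear[of c "m $ 3"] by blast
    then have "i \<noteq> 2 \<and> meets A i c \<or> i \<noteq> 1 \<and> meets C i c"
      using c mA mC by cases simp_all
    then show ?thesis
      using P_ge[rule_format, OF c] Q_gt[of i c] R_gt[of i c] Q_ge[of i c] R_ge[of i c] by linarith
  qed
  show ?case
  proof (rule exI[of _ R], rule exI[of _ A1], rule exI[of _ C1], intro conjI allI impI)
    show "brick_partition (cbox a b) R" "card R = 2 * Suc n + 5" "A1 \<in> R" "C1 \<in> R" "A1 \<noteq> C1"
      by fact+
    show "Suc n + 3 \<le> card {D \<in> R. meets D i c}" if "a $ i \<le> c \<and> c \<le> b $ i" for i c
      using count that .
  qed (simp_all add: A1 C1 mA mC)
qed

lemma slicing_example:
  fixes B :: "(real ^ 3) set"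
  assumes "brick B" and k: "3 \<le> k"
  shows "\<exists>P. slicing k B P \<and> card P = 2 * k - 1"
proof -
  obtain a b where ab: "\<forall>i. a $ i < b $ i" and B: "B = cbox a b"
    using assms by (auto simp: brick_def)
  define m where "m = (\<chi> i. (a $ i + b $ i) / 2)"
  have m: "\<forall>i. a $ i < m $ i" "\<forall>i. m $ i < b $ i"
    using ab by (auto simp: m_def field_simps)
  obtain P where P: "brick_partition (cbox a b) P" "card P = 2 * (k - 3) + 5"
    and P_ge: "\<forall>i c. a $ i \<le> c \<and> c \<le> b $ i \<longrightarrow> k - 3 + 3 \<le> card {D \<in> P. meets D i c}"
    using pinwheel_refinement[OF m, of "k - 3"] by blast
  have "slicing k B P"
    using P(1) P_ge k by (simp add: B slicing_3_iff[OF ab])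
  moreover have "card P = 2 * k - 1"
    using P(2) k by simp
  ultimately show ?thesis
    by blast
qed

theorem theorem1p4:
  fixes B :: "(real ^ 3) set"
  assumes "brick B"
  shows "(\<forall>k::nat. k \<ge> 3 \<longrightarrow> min_slicing_size B k = enat (2 * k - 1)) \<and>
         min_slicing_size B 2 = enat 4"
proof (intro conjI allI impI)
  fix k :: nat
  assume k: "k \<ge> 3"
  then have "2 * k - 1 \<le> card P" if "slicing k B P" for P
    using slicing_lower_bounds(1)[OF assms that] by linarith
  then show "min_slicing_size B k = enat (2 * k - 1)"
    unfolding min_slicing_size_eq_enat_iff using slicing_example[OF assms k] by blast
next
  have "4 \<le> card P" if "slicing 2 B P" for P
    using slicing_lower_bounds(2)[OF assms that] by linarith
  then show "min_slicing_size B 2 = enat 4"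
    unfolding min_slicing_size_eq_enat_iff using slicing_2_example[OF assms] by blast
qed

end
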